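(* Let $p$ be an odd prime with $p \equiv 2 \pmod 3$, and let $c$ be an integer with $1 \le c \le p-1$. Let $M_p = [m_{ij}]_{1 \le i,j \le p}$ be the $p \times p$ matrix with entries $m_{ij} = \left[ \frac{j-i+c}{p} \right]$. Then $\det(M_p) = p-1$.
   Context: For an odd prime $p$ and an integer $a$, the cubic residue symbol is defined by $\left[ \frac{a}{p} \right] = 1$ if $a \not\equiv 0 \pmod p$ and $x^3 \equiv a \pmod p$ has an integer solution; $\left[ \frac{a}{p} \right] = -1$ if $x^3 \equiv a \pmod p$ has no integer solution; and $\left[ \frac{a}{p} \right] = 0$ if $a \equiv 0 \pmod p$. *)

theory Defs
  imports "HOL-Number_Theory.Cong" "Jordan_Normal_Form.Determinant"
begin

definition cubic_residue_symbol :: "int \<Rightarrow> nat \<Rightarrow> int" where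
  "cubic_residue_symbol a p =
     (if [a = 0] (mod int p) then 0
      else if \<exists>x::int. [x ^ 3 = a] (mod int p) then 1
      else -1)"

(* Matrix indices run over 0..<p instead of 1..p; the entries depend only on j - i,
   which the shift leaves unchanged. *)
definition cubic_residue_matrix :: "nat \<Rightarrow> int \<Rightarrow> int mat" where
  "cubic_residue_matrix p c =
     mat p p (\<lambda>(i, j). cubic_residue_symbol (int j - int i + c) p)"

end

theory Submission
  imports Defs "HOL-Number_Theory.Residues"
begin

text \<open>
  Since every residue is a cube modulo \<open>p\<close>, the matrix is the all-ones matrix minus a
  permutation matrix. That permutation is a cyclic shift; as \<open>p\<close> is odd, it is the square of
  another shift, hence even, and the determinant is that of the all-ones matrix minus the identity.
\<close>

text \<open>Here \<open>p - 1\<close> is congruent to 1 modulo 3, hence coprime to 3, so cubing is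
  invertible on the nonzero residues. Fermat's theorem gives the inverse as an explicit
  power.\<close>

lemma cube_root_exists_mod_prime:
  fixes p :: nat and a :: int
  assumes "prime p" and p: "[p = 2] (mod 3)" and a: "\<not> [a = 0] (mod int p)"
  shows "\<exists>x::int. [x ^ 3 = a] (mod int p)"
proof -
  define m where "m = p div 3"
  have "p mod 3 = 2" using p by (simp add: cong_def)
  then have pm: "p - 1 = 3 * m + 1" by (simp add: m_def) presburger
  have "p > 0" using \<open>prime p\<close> by (rule prime_gt_0_nat)
  \<comment> \<open>\<open>fermat_theorem\<close> is applied over the naturals, so \<open>a\<close>
    is first replaced by its least nonnegative residue.\<close>
  define b where "b = nat (a mod int p)"
  have b: "int b = a mod int p" using \<open>p > 0\<close> by (simp add: b_def)
  have "\<not> int p dvd int b" using a by (simp add: b cong_0_iff dvd_mod_iff)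
  then have "[b ^ (p - 1) = 1] (mod p)"
    using fermat_theorem \<open>prime p\<close> by (simp only: int_dvd_int_iff)
  then have "[int b ^ (p - 1) = 1] (mod int p)"
    by (simp flip: cong_int_iff)
  moreover have "[int b ^ (p - 1) = a ^ (p - 1)] (mod int p)"
    unfolding b by (intro cong_pow) simp
  ultimately have "[a ^ (p - 1) = 1] (mod int p)"
    by (simp add: cong_def)
  \<comment> \<open>As \<open>2 (p - 1) + 1 = 3 (2 m + 1)\<close>, a cube root of \<open>a\<close> is \<open>a ^ (2 m + 1)\<close>.\<close>
  then have "[a ^ (3 * m + 1) * a ^ (3 * m + 1) * a = 1 * 1 * a] (mod int p)"
    unfolding pm by (intro cong_mult cong_refl)
  also have "a ^ (3 * m + 1) * a ^ (3 * m + 1) * a = (a ^ (2 * m + 1)) ^ 3"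
    by (simp add: power_mult power_mult_distrib power2_eq_square power3_eq_cube mult_ac)
  finally show ?thesis by auto
qed

text \<open>
  With \<open>S\<close> the identity matrix whose first row is replaced by ones, \<open>S\<close> conjugates
  the matrix to a lower triangular one.
\<close>

lemma det_all_ones_minus_one_mat:
  assumes "n > 0"
  shows "det (mat n n (\<lambda>(i, j). if i = j then 0 else 1 :: 'a :: idom))
    = of_nat (n - 1) * (- 1) ^ (n - 1)" (is "det ?A = _")
proof -
  define S :: "'a mat" where "S = mat n n (\<lambda>(i, j). if i = 0 \<or> i = j then 1 else 0)"
  \<comment> \<open>\<open>L\<close> expresses the rows of \<open>S * ?A\<close> through those of
    \<open>S\<close>. Every column of \<open>?A\<close> sums to \<open>n - 1\<close>, so row 0 is
    \<open>n - 1\<close> times the all-ones row of \<open>S\<close>; row \<open>i > 0\<close> is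
    that all-ones row minus the \<open>i\<close>-th unit row, which is row \<open>i\<close> of
    \<open>S\<close>.\<close>
  define L :: "'a mat" where "L = mat n n (\<lambda>(i, j).
    if i = 0 then if j = 0 then of_nat (n - 1) else 0
    else (if j = 0 then 1 else 0) - (if i = j then 1 else 0))"
  have S: "S \<in> carrier_mat n n" and L: "L \<in> carrier_mat n n" and A: "?A \<in> carrier_mat n n"
    by (simp_all add: S_def L_def)
  have "S * ?A = L * S"
  proof (rule eq_matI)
    fix i j assume "i < dim_row (L * S)" "j < dim_col (L * S)"
    then have i: "i < n" and j: "j < n" by (simp_all add: S_def L_def)
    have "(S * ?A) $$ (i, j) = (\<Sum>k<n. S $$ (i, k) * ?A $$ (k, j))"
      using i j by (simp add: S_def scalar_prod_def atLeast0LessThan)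
    also have "\<dots> = (\<Sum>k<n. L $$ (i, k) * S $$ (k, j))"
    proof (cases "i = 0")
      case True
      have "(\<Sum>k<n. S $$ (i, k) * ?A $$ (k, j)) = (\<Sum>k<n. 1 - (if k = j then 1 else 0))"
        using j True by (intro sum.cong) (auto simp: S_def)
      also have "\<dots> = of_nat (n - 1)"
        using j by (simp add: sum_subtractf of_nat_diff)
      also have "\<dots> = (\<Sum>k<n. if k = 0 then of_nat (n - 1) else 0)"
        using j by simp
      also have "\<dots> = (\<Sum>k<n. L $$ (i, k) * S $$ (k, j))"
        using j True by (intro sum.cong) (auto simp: S_def L_def)
      finally show ?thesis .
    next
      case False
      have "(\<Sum>k<n. S $$ (i, k) * ?A $$ (k, j)) = (\<Sum>k<n. if k = i then ?A $$ (i, j) else 0)"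
        using i j False by (intro sum.cong) (auto simp: S_def)
      also have "\<dots> = 1 - (if i = j then 1 else 0)"
        using i j by simp
      also have "\<dots> = (\<Sum>k<n. (if k = 0 then 1 else 0) - (if k = i then if i = j then 1 else 0 else 0))"
        using i j by (simp add: sum_subtractf)
      also have "\<dots> = (\<Sum>k<n. L $$ (i, k) * S $$ (k, j))"
        using i j False by (intro sum.cong) (auto simp: S_def L_def)
      finally show ?thesis .
    qed
    also have "\<dots> = (L * S) $$ (i, j)"
      using i j by (simp add: S_def L_def scalar_prod_def atLeast0LessThan)
    finally show "(S * ?A) $$ (i, j) = (L * S) $$ (i, j)" .
  qed (simp_all add: S_def L_def)
  then have "det S * det ?A = det L * det S"
    by (simp only: flip: det_mult[OF S A] det_mult[OF L S])
  moreover have "det S = 1"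
  proof -
    have "det S = prod_list (diag_mat S)"
      by (rule det_upper_triangular[OF _ S]) (auto simp: S_def)
    also have "diag_mat S = replicate n 1"
      by (auto simp: diag_mat_def S_def intro!: nth_equalityI)
    finally show ?thesis by simp
  qed
  moreover have "det L = of_nat (n - 1) * (- 1) ^ (n - 1)"
  proof -
    have "det L = prod_list (diag_mat L)"
      by (rule det_lower_triangular[OF _ L]) (auto simp: L_def)
    also have "diag_mat L = of_nat (n - 1) # replicate (n - 1) (- 1)"
      using assms by (auto simp: diag_mat_def L_def nth_Cons intro!: nth_equalityI split: nat.split)
    finally show ?thesis by simp
  qed
  ultimately show ?thesis by simp
qed

text \<open>Adding \<open>k\<close> is injective modulo \<open>n\<close>, hence bijective on the
  finite set of residues. The identity branch is there because \<open>permutes\<close> requires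
  points outside the set to be fixed.\<close>

lemma shift_mod_permutes:
  "(\<lambda>i. if i < n then (i + k) mod n else i) permutes {0..<n::nat}"
proof (rule bij_imp_permutes)
  let ?f = "\<lambda>i. if i < n then (i + k) mod n else i"
  have "inj_on ?f {0..<n}"
  proof (rule inj_onI)
    fix x y assume "x \<in> {0..<n}" "y \<in> {0..<n}" "?f x = ?f y"
    then have "[x + k = y + k] (mod n)" and xy: "x < n" "y < n" by (simp_all add: cong_def)
    then have "[x = y] (mod n)" by (simp only: cong_add_rcancel_nat)
    then show "x = y" using xy by (simp add: cong_def)
  qed
  moreover have "?f ` {0..<n} \<subseteq> {0..<n}" by auto
  ultimately show "bij_betw ?f {0..<n} {0..<n}"
    unfolding bij_betw_def using endo_inj_surj[OF finite_atLeastLessThan] by meson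
qed simp

theorem theorem3p5:
  fixes p :: nat and c :: int
  assumes "prime p" and "odd p" and "[p = 2] (mod 3)"
    and "1 \<le> c" and "c \<le> int p - 1"
  shows "det (cubic_residue_matrix p c) = int p - 1"
proof -
  have p0: "p > 0" using \<open>prime p\<close> by (rule prime_gt_0_nat)
  define A :: "int mat" where "A = mat p p (\<lambda>(i, j). if i = j then 0 else 1)"
  \<comment> \<open>The halving is exact because \<open>p\<close> is odd, so \<open>2 * k\<close> is
    \<open>(p - 1) * c\<close>, congruent to \<open>- c\<close> modulo \<open>p\<close>. Two shifts
    by \<open>k\<close> thus send a row \<open>i\<close> to \<open>i - c\<close> modulo
    \<open>p\<close>, the column of its only zero entry.\<close>
  define k where "k = (p - 1) div 2 * nat c"
  define \<sigma> where "\<sigma> i = (if i < p then (i + k) mod p else i)" for i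
  have k: "2 * int k = int p * c - c"
  proof -
    have "2 * int ((p - 1) div 2) = int p - 1"
      using \<open>odd p\<close> p0 by (auto elim!: oddE)
    then have "2 * int k = (int p - 1) * c"
      using \<open>1 \<le> c\<close> by (simp add: k_def flip: mult.assoc)
    then show ?thesis by (simp add: algebra_simps)
  qed
  have \<sigma>: "\<sigma> permutes {0..<p}"
    unfolding \<sigma>_def by (rule shift_mod_permutes)
  have \<sigma>\<sigma>: "(\<sigma> \<circ> \<sigma>) permutes {0..<p}" using \<sigma> \<sigma> by (rule permutes_compose)
  have "permutation \<sigma>" using \<sigma> by (auto simp: permutation_permutes)
  then have sign: "sign (\<sigma> \<circ> \<sigma>) = 1"
    by (simp add: sign_compose)
  have "cubic_residue_matrix p c = mat p p (\<lambda>(i, j). A $$ ((\<sigma> \<circ> \<sigma>) i, j))"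
  proof (rule eq_matI)
    fix i j assume "i < dim_row (mat p p (\<lambda>(i, j). A $$ ((\<sigma> \<circ> \<sigma>) i, j)))"
      "j < dim_col (mat p p (\<lambda>(i, j). A $$ ((\<sigma> \<circ> \<sigma>) i, j)))"
    then have i: "i < p" and j: "j < p" by simp_all
    have \<sigma>i: "(\<sigma> \<circ> \<sigma>) i = (i + 2 * k) mod p"
      using i p0 by (simp add: \<sigma>_def mod_simps add.assoc mult_2)
    have "(\<sigma> \<circ> \<sigma>) i = j \<longleftrightarrow> [i + 2 * k = j] (mod p)"
      unfolding \<sigma>i using j by (simp add: cong_def)
    also have "\<dots> \<longleftrightarrow> [int i + 2 * int k = int j] (mod int p)"
      by (simp flip: cong_int_iff)
    \<comment> \<open>By the fact \<open>k\<close>, left side minus right side of the previous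
      congruence is \<open>int p * c - (int j - int i + c)\<close>.\<close>
    also have "\<dots> \<longleftrightarrow> [int j - int i + c = 0] (mod int p)"
      unfolding k cong_iff_dvd_diff by (smt (verit) dvd_diff_right_iff dvd_triv_left dvd_minus_iff)
    finally have "(\<sigma> \<circ> \<sigma>) i = j \<longleftrightarrow> [int j - int i + c = 0] (mod int p)" .
    moreover have "(\<sigma> \<circ> \<sigma>) i < p" unfolding \<sigma>i using p0 by simp
    ultimately show "cubic_residue_matrix p c $$ (i, j)
        = mat p p (\<lambda>(i, j). A $$ ((\<sigma> \<circ> \<sigma>) i, j)) $$ (i, j)"
      using i j cube_root_exists_mod_prime[OF \<open>prime p\<close> \<open>[p = 2] (mod 3)\<close>, of "int j - int i + c"]
      by (auto simp: cubic_residue_matrix_def cubic_residue_symbol_def A_def)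
  qed (simp_all add: cubic_residue_matrix_def)
  then have "det (cubic_residue_matrix p c) = signof (\<sigma> \<circ> \<sigma>) * det A"
    using det_permute_rows[of A p "\<sigma> \<circ> \<sigma>"] \<sigma>\<sigma> by (simp add: A_def)
  \<comment> \<open>The factor \<open>(- 1) ^ (p - 1)\<close> is 1 because \<open>p\<close> is
    odd.\<close>
  also have "\<dots> = int p - 1"
    using det_all_ones_minus_one_mat[OF p0, where ?'a = int] \<open>odd p\<close> p0
    by (simp add: sign A_def of_nat_diff)
  finally show ?thesis .
qed

end
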